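(* Let $U\subset\mathbb{R}$ be a connected bounded set, let $\mu$ be a nonnegative measure on $U$ with $\mu(U)=\int_U d\mu(s)<+\infty$, and let $f:U\to\mathbb{R}^n$ be bounded and measurable on $U$. Let $f^-,f^+\in\mathbb{R}^n$ be such that $f^-\le f(\cdot)\le f^+$ almost everywhere on $U$, and set $\delta_f=f^+-f^-$. With the convex function $\phi(z)=z^Tz$, the Jensen's gap verifies $$\mu(U)\int_U\phi(f(s))\,d\mu(s)-\phi\left(\int_U f(s)\,d\mu(s)\right)\le\frac{\mu(U)^2}{4}\,\phi(\delta_f).$$ Moreover, the constant term $1/4$ in the right-hand side is sharp and is obtained for the functions $f_i(s)=\operatorname{sgn}\left(s-(a+b)/2\right)$, $i=1,\ldots,n$, with $a=\inf\{s\in U\}$ and $b=\sup\{s\in U\}$.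
   Context: For $u,v\in\mathbb{R}^n$, $u\le v$ means componentwise inequality. $\operatorname{sgn}$ denotes the signum function, and $f_i$ is the $i$-th component of $f$. Integrals of vector-valued functions are taken componentwise. The Jensen's gap is the left-hand side of the displayed inequality.
   Formalization: Attainment by the sign functions and sharpness of 1/4 fail for arbitrary μ (e.g. a point mass); they are stated for μ giving mass μ(U)/2 to each side of (a+b)/2 (sharpness also needs μ(U)>0), and Lebesgue measure is shown to be such a measure when a<b. *)

theory Defs
  imports "HOL-Analysis.Analysis"
begin

text \<open>
  A finite nonnegative measure on \<open>U\<close>. Its \<open>\<sigma>\<close>-algebra may be any one that contains the
  Borel sets of \<open>U\<close>, so that Borel measures, Lebesgue measure and completions are all covered.
\<close>
definition finite_measure_on :: "real set \<Rightarrow> real measure \<Rightarrow> bool" where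
  "finite_measure_on U M \<longleftrightarrow>
     finite_measure M \<and> space M = U \<and> sets (restrict_space borel U) \<subseteq> sets M"

definition phi :: "real ^ 'n \<Rightarrow> real" where
  "phi z = z \<bullet> z"

definition vec_integral :: "real measure \<Rightarrow> (real \<Rightarrow> real ^ 'n) \<Rightarrow> real ^ 'n" where
  "vec_integral M f = (\<chi> i. LINT s|M. f s $ i)"

definition jensen_gap :: "real set \<Rightarrow> real measure \<Rightarrow> (real \<Rightarrow> real ^ 'n) \<Rightarrow> real" where
  "jensen_gap U M f = measure M U * (LINT s|M. phi (f s)) - phi (vec_integral M f)"

text \<open>
  The standing assumptions on \<open>f\<close>, \<open>f\<^sup>-\<close> (here \<open>lo\<close>) and \<open>f\<^sup>+\<close> (here \<open>hi\<close>). The order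
  on \<open>real ^ 'n\<close> is the componentwise one; values of \<open>f\<close> outside \<open>U = space M\<close> are irrelevant.
\<close>
definition bounded_between ::
    "real set \<Rightarrow> real measure \<Rightarrow> (real \<Rightarrow> real ^ 'n) \<Rightarrow> real ^ 'n \<Rightarrow> real ^ 'n \<Rightarrow> bool" where
  "bounded_between U M f lo hi \<longleftrightarrow>
     bounded (f ` U) \<and> f \<in> borel_measurable M \<and> (AE s in M. lo \<le> f s \<and> f s \<le> hi)"

definition midpt :: "real set \<Rightarrow> real" where
  "midpt U = (Inf U + Sup U) / 2"

definition sgn_step :: "real set \<Rightarrow> real \<Rightarrow> real ^ 'n" where
  "sgn_step U s = (\<chi> i. sgn (s - midpt U))"

text \<open>
  The sign functions do not attain the bound for every \<open>\<mu>\<close> (for a point mass the gap is \<open>0\<close>);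
  they do when the midpoint splits the mass evenly, as it does for Lebesgue measure.
\<close>
definition equal_halves :: "real set \<Rightarrow> real measure \<Rightarrow> bool" where
  "equal_halves U M \<longleftrightarrow>
     measure M {s \<in> U. s < midpt U} = measure M U / 2 \<and>
     measure M {s \<in> U. midpt U < s} = measure M U / 2"

end

theory Submission
  imports Defs
begin

text \<open>
  Componentwise, integrating \<open>(g - lo) * (hi - g) \<ge> 0\<close> bounds the second moment of \<open>g\<close> by a
  linear function of its first moment \<open>I\<close>; the resulting upper bound for the gap falls short of
  \<open>\<mu>(U)\<^sup>2 * (hi - lo)\<^sup>2 / 4\<close> by the square \<open>(I - \<mu>(U) * (lo + hi) / 2)\<^sup>2\<close>.
\<close>

lemma (in finite_measure) variance_gap_le:
  fixes g :: "'a \<Rightarrow> real"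
  assumes g: "integrable M g" and g2: "integrable M (\<lambda>s. (g s)\<^sup>2)"
    and ae: "AE s in M. lo \<le> g s \<and> g s \<le> hi"
  shows "measure M (space M) * (LINT s|M. (g s)\<^sup>2) - (LINT s|M. g s)\<^sup>2
           \<le> (measure M (space M))\<^sup>2 / 4 * (hi - lo)\<^sup>2"
proof -
  let ?m = "measure M (space M)" and ?I = "LINT s|M. g s"
  have "AE s in M. (g s)\<^sup>2 \<le> (lo + hi) * g s - lo * hi"
    using ae
  proof eventually_elim
    case (elim s)
    then have "0 \<le> (g s - lo) * (hi - g s)" by simp
    then show ?case by (simp add: algebra_simps power2_eq_square)
  qed
  then have "(LINT s|M. (g s)\<^sup>2) \<le> (LINT s|M. (lo + hi) * g s - lo * hi)"
    using g g2 by (intro integral_mono_AE) auto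
  also have "\<dots> = (lo + hi) * ?I - lo * hi * ?m"
    using g by (simp add: mult.commute)
  finally have "?m * (LINT s|M. (g s)\<^sup>2) \<le> ?m * ((lo + hi) * ?I - lo * hi * ?m)"
    by (rule mult_left_mono) simp
  moreover have "?m\<^sup>2 / 4 * (hi - lo)\<^sup>2 - (?m * ((lo + hi) * ?I - lo * hi * ?m) - ?I\<^sup>2)
      = (?I - ?m * (lo + hi) / 2)\<^sup>2"
    by (simp add: power2_eq_square field_simps)
  ultimately show ?thesis
    using zero_le_power2[of "?I - ?m * (lo + hi) / 2"] by linarith
qed

lemma phi_eq_sum: "phi (z :: real ^ 'n) = (\<Sum>i\<in>UNIV. (z $ i)\<^sup>2)"
  by (simp add: phi_def inner_vec_def power2_eq_square)

text \<open>The bound on \<open>f\<close> holds at every point of \<open>U\<close>, so constants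
  dominate each component and its square, and constants are integrable for a finite measure.\<close>

lemma bounded_between_integrable:
  fixes f :: "real \<Rightarrow> real ^ 'n"
  assumes M: "finite_measure_on U M" and f: "bounded_between U M f lo hi"
  shows "integrable M (\<lambda>s. f s $ i)" and "integrable M (\<lambda>s. (f s $ i)\<^sup>2)"
proof -
  interpret finite_measure M using M by (simp add: finite_measure_on_def)
  have U: "space M = U" using M by (simp add: finite_measure_on_def)
  have meas [measurable]: "f \<in> borel_measurable M" using f by (simp add: bounded_between_def)
  obtain B where B: "\<And>s. s \<in> U \<Longrightarrow> norm (f s) \<le> B"
    using f unfolding bounded_between_def bounded_iff by auto
  have c: "(\<lambda>s. f s $ i) \<in> borel_measurable M"
  proof -
    \<comment> \<open>A component is an inner product with a fixed axis vector, which reduces its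
      measurability to that of \<open>f\<close>.\<close>
    have "(\<lambda>s. f s \<bullet> axis i 1) \<in> borel_measurable M" by measurable
    then show ?thesis by (simp add: inner_axis)
  qed
  have bd: "\<bar>f s $ i\<bar> \<le> B" if "s \<in> U" for s
    using B[OF that] component_le_norm_cart[of "f s" i] by simp
  show "integrable M (\<lambda>s. f s $ i)"
    using c bd by (intro integrable_const_bound[where B = B]) (auto simp: U)
  have "(f s $ i)\<^sup>2 \<le> B\<^sup>2" if "s \<in> U" for s
    using power_mono[OF bd[OF that], of 2] by simp
  then show "integrable M (\<lambda>s. (f s $ i)\<^sup>2)"
    using c by (intro integrable_const_bound[where B = "B\<^sup>2"]) (auto simp: U)
qed

text \<open>Since \<open>phi\<close> is a sum of squares of coordinates, the gap decouples into
  scalar gaps. Exchanging the integral with the finite sum uses integrability of the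
  squares.\<close>

lemma jensen_gap_eq_sum:
  fixes f :: "real \<Rightarrow> real ^ 'n"
  assumes "finite_measure_on U M" and "bounded_between U M f lo hi"
  shows "jensen_gap U M f =
    (\<Sum>i\<in>UNIV. measure M U * (LINT s|M. (f s $ i)\<^sup>2) - (LINT s|M. f s $ i)\<^sup>2)"
  using bounded_between_integrable(2)[OF assms]
  by (simp add: jensen_gap_def phi_eq_sum vec_integral_def sum_subtractf sum_distrib_left)

lemma jensen_gap_le:
  fixes f :: "real \<Rightarrow> real ^ 'n"
  assumes M: "finite_measure_on U M" and f: "bounded_between U M f lo hi"
  shows "jensen_gap U M f \<le> (measure M U)\<^sup>2 / 4 * phi (hi - lo)"
proof -
  interpret finite_measure M using M by (simp add: finite_measure_on_def)
  have U: "space M = U" using M by (simp add: finite_measure_on_def)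
  have "AE s in M. lo $ i \<le> f s $ i \<and> f s $ i \<le> hi $ i" for i
    using f by (auto simp: bounded_between_def less_eq_vec_def)
  \<comment> \<open>The index \<open>i\<close> is still schematic here, so the scalar estimate can
    be summed over all coordinates.\<close>
  from variance_gap_le[OF bounded_between_integrable[OF M f] this]
  show ?thesis
    by (simp add: jensen_gap_eq_sum[OF M f] phi_eq_sum sum_distrib_left U sum_mono)
qed

lemma bounded_between_sgn_step:
  assumes M: "finite_measure_on U M"
  shows "bounded_between U M (sgn_step U :: real \<Rightarrow> real ^ 'n) (vec (- 1)) (vec 1)"
proof -
  have "(sgn_step U :: real \<Rightarrow> real ^ 'n) ` U
      \<subseteq> {(\<chi> i. - 1), (\<chi> i. 0), (\<chi> i. 1)}"
    by (auto simp: sgn_step_def sgn_if)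
  then have "bounded ((sgn_step U :: real \<Rightarrow> real ^ 'n) ` U)"
    by (rule bounded_subset[rotated]) (simp add: finite_imp_bounded)
  moreover have "(\<lambda>s. sgn (s - midpt U) :: real) \<in> borel_measurable M"
  proof -
    \<comment> \<open>Measurability is shown for the Borel sets of \<open>U\<close> and then passes
      to \<open>M\<close>, which has the same space and contains those sets.\<close>
    have "(\<lambda>s. sgn (s - midpt U)) \<in> borel_measurable (restrict_space borel U)"
      by (intro measurable_restrict_space1) measurable
    then show ?thesis
      using M unfolding measurable_def finite_measure_on_def by (auto simp: space_restrict_space)
  qed
  then have "(sgn_step U :: real \<Rightarrow> real ^ 'n) \<in> borel_measurable M"
    unfolding sgn_step_def [abs_def] borel_measurable_euclidean_space[where 'c = "real ^ 'n"]
    by (auto simp: Basis_vec_def inner_axis)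
  ultimately show ?thesis
    by (auto simp: bounded_between_def less_eq_vec_def sgn_step_def sgn_if)
qed

text \<open>The two halves cancel in the first moment and together carry the whole mass in the
  second. With \<open>m = measure M U\<close>, each coordinate thus has gap
  \<open>m * m - 0\<close>, which equals \<open>m\<^sup>2 / 4 * 2\<^sup>2\<close>.\<close>

lemma jensen_gap_sgn_step:
  assumes M: "finite_measure_on U M" and eh: "equal_halves U M"
  shows "jensen_gap U M (sgn_step U :: real \<Rightarrow> real ^ 'n)
    = (measure M U)\<^sup>2 / 4 * phi (vec 1 - vec (- 1) :: real ^ 'n)"
proof -
  interpret finite_measure M using M by (simp add: finite_measure_on_def)
  have U: "space M = U" using M by (simp add: finite_measure_on_def)
  let ?L = "{s \<in> U. s < midpt U}" and ?R = "{s \<in> U. midpt U < s}"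
  have "U \<inter> {..< midpt U} \<in> sets M" "U \<inter> {midpt U <..} \<in> sets M"
    using M by (auto simp: finite_measure_on_def sets_restrict_space subset_iff)
  moreover have "?L = U \<inter> {..< midpt U}" "?R = U \<inter> {midpt U <..}" by auto
  ultimately have LR [measurable]: "?L \<in> sets M" "?R \<in> sets M" by simp_all
  have int: "?L \<inter> U = ?L" "?R \<inter> U = ?R" by auto
  \<comment> \<open>As \<open>sgn 0 = 0\<close>, this pointwise identity and the one for the square
    below also hold at the midpoint, where both indicators vanish.\<close>
  have "(LINT s|M. sgn (s - midpt U)) = (LINT s|M. indicator ?R s - indicator ?L s)"
    by (rule Bochner_Integration.integral_cong) (auto simp: U sgn_if indicator_def)
  also have "\<dots> = measure M ?R - measure M ?L"
    by (subst Bochner_Integration.integral_diff) (auto simp: U int less_top[symmetric])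
  finally have 1: "(LINT s|M. sgn (s - midpt U)) = 0"
    using eh by (simp add: equal_halves_def)
  have "(LINT s|M. (sgn (s - midpt U))\<^sup>2) = (LINT s|M. indicator ?R s + indicator ?L s)"
    by (rule Bochner_Integration.integral_cong) (auto simp: U sgn_if indicator_def)
  also have "\<dots> = measure M ?R + measure M ?L"
    by (subst Bochner_Integration.integral_add) (auto simp: U int less_top[symmetric])
  finally have 2: "(LINT s|M. (sgn (s - midpt U))\<^sup>2) = measure M U"
    using eh by (simp add: equal_halves_def)
  show ?thesis
    unfolding jensen_gap_eq_sum[OF M bounded_between_sgn_step[OF M]] phi_eq_sum
    by (simp add: sgn_step_def 1 2) (simp add: power2_eq_square)
qed

text \<open>Testing the assumed bound on \<open>sgn_step\<close>, where the bound with
  \<open>1 / 4\<close> is an equality, leaves a common factor to cancel.\<close>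

lemma sharp_constant:
  assumes M: "finite_measure_on U M" and eh: "equal_halves U M" and pos: "0 < measure M U"
    and c: "\<And>(f :: real \<Rightarrow> real ^ 'n) lo hi. bounded_between U M f lo hi \<Longrightarrow>
      jensen_gap U M f \<le> c * (measure M U)\<^sup>2 * phi (hi - lo)"
  shows "1 / 4 \<le> c"
proof -
  let ?d = "(measure M U)\<^sup>2 * phi (vec 1 - vec (- 1) :: real ^ 'n)"
  have "1 / 4 * ?d \<le> c * ?d"
    using c[OF bounded_between_sgn_step[OF M]] jensen_gap_sgn_step[OF M eh, where 'n = 'n] by simp
  \<comment> \<open>The factor is \<open>4 * (measure M U)\<^sup>2\<close> times the dimension,
    which is positive because an index type is nonempty.\<close>
  moreover have "0 < ?d"
    using pos by (simp add: phi_eq_sum)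
  ultimately show ?thesis by (rule mult_right_le_imp_le)
qed

text \<open>The open and the closed interval have the same length, so it does not matter which
  endpoints lie in \<open>S\<close>. This serves for \<open>U\<close> and for both of its
  halves.\<close>

lemma measure_lebesgue_between_intervals:
  fixes a b :: real
  assumes "a \<le> b" "{a<..<b} \<subseteq> S" "S \<subseteq> {a..b}" "S \<in> sets lebesgue"
  shows "measure lebesgue S = b - a"
proof (rule antisym)
  have S: "S \<in> lmeasurable"
    using fmeasurableI2[OF _ assms(3,4)] by simp
  show "measure lebesgue S \<le> b - a"
    using measure_mono_fmeasurable[OF assms(3,4)] assms(1) by simp
  show "b - a \<le> measure lebesgue S"
    using measure_mono_fmeasurable[OF assms(2) _ S] assms(1) by simp
qed

lemma interval_between_Inf_Sup:
  fixes U :: "real set"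
  assumes "connected U" "bounded U" "U \<noteq> {}"
  shows "{Inf U<..<Sup U} \<subseteq> U" and "U \<subseteq> {Inf U..Sup U}"
proof -
  have bdd: "bdd_below U" "bdd_above U"
    using assms(2) by (auto intro: bounded_imp_bdd_below bounded_imp_bdd_above)
  then show "U \<subseteq> {Inf U..Sup U}" by (auto intro: cInf_lower cSup_upper)
  show "{Inf U<..<Sup U} \<subseteq> U"
  proof
    fix x assume "x \<in> {Inf U<..<Sup U}"
    then obtain y z where "y \<in> U" "y < x" "z \<in> U" "x < z"
      using cInf_less_iff[OF assms(3) bdd(1)] less_cSup_iff[OF assms(3) bdd(2)] by auto
    then show "x \<in> U"
      using assms(1) unfolding connected_iff_interval by (meson less_imp_le)
  qed
qed

text \<open>Every nondegenerate \<open>U\<close> thus carries a measure of positive mass for which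
  the sign functions attain the bound, so the sharpness claim is not vacuous.\<close>

lemma lebesgue_on_equal_halves:
  fixes U :: "real set"
  assumes "connected U" "bounded U" "U \<noteq> {}" and less: "Inf U < Sup U"
  shows "finite_measure_on U (lebesgue_on U)" and "equal_halves U (lebesgue_on U)"
    and "0 < measure (lebesgue_on U) U"
proof -
  note sub = interval_between_Inf_Sup[OF assms(1-3)]
  \<comment> \<open>A connected set of reals is an interval, hence Borel. Therefore Borel subsets of
    \<open>U\<close> are Lebesgue measurable.\<close>
  have borelU: "U \<in> sets borel"
    using assms(1) by (simp add: is_interval_connected_1[symmetric] real_interval_borel_measurable)
  then have U: "U \<in> sets lebesgue" by simp
  have "{s \<in> U. s < midpt U} = U \<inter> {..< midpt U}" "{s \<in> U. midpt U < s} = U \<inter> {midpt U <..}"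
    by auto
  moreover have "U \<inter> {..< midpt U} \<in> sets lebesgue" "U \<inter> {midpt U <..} \<in> sets lebesgue"
    using U by auto
  ultimately have LR:
    "{s \<in> U. s < midpt U} \<in> sets lebesgue" "{s \<in> U. midpt U < s} \<in> sets lebesgue"
    by simp_all
  have mU: "measure (lebesgue_on U) U = Sup U - Inf U"
    using measure_lebesgue_between_intervals[OF less_imp_le[OF less] sub U] U
    by (simp add: measure_restrict_space)
  then show "0 < measure (lebesgue_on U) U" using less by simp
  have "U \<in> lmeasurable"
    using fmeasurableI2[OF _ sub(2) U] by simp
  then show "finite_measure_on U (lebesgue_on U)"
    using borelU by (auto simp: finite_measure_on_def finite_measure_lebesgue_on
        sets_restrict_space)
  \<comment> \<open>Each half lies between the open and the closed interval from the midpoint to an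
    end of \<open>U\<close>, and these two intervals are equally long.\<close>
  have "measure lebesgue {s \<in> U. s < midpt U} = midpt U - Inf U"
    using less sub by (intro measure_lebesgue_between_intervals LR) (auto simp: midpt_def)
  moreover have "measure lebesgue {s \<in> U. midpt U < s} = Sup U - midpt U"
    using less sub by (intro measure_lebesgue_between_intervals LR) (auto simp: midpt_def)
  ultimately show "equal_halves U (lebesgue_on U)"
    using U by (auto simp: equal_halves_def mU measure_restrict_space midpt_def field_simps)
qed

text \<open>Sharpness appears in two forms: equality for the sign functions, and
  \<open>1 / 4\<close> as a lower bound for every admissible constant. The last conjunct provides a
  measure to which both apply.\<close>

theorem mainTheorem1:
  fixes U :: "real set"
  assumes "connected U" and "bounded U"
  shows
    "(\<forall>M (f :: real \<Rightarrow> real ^ 'n) lo hi.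
        finite_measure_on U M \<and> bounded_between U M f lo hi \<longrightarrow>
        jensen_gap U M f \<le> (measure M U)\<^sup>2 / 4 * phi (hi - lo))
     \<and>
     (\<forall>M. finite_measure_on U M \<and> equal_halves U M \<longrightarrow>
        bounded_between U M (sgn_step U :: real \<Rightarrow> real ^ 'n) (vec (- 1)) (vec 1) \<and>
        jensen_gap U M (sgn_step U :: real \<Rightarrow> real ^ 'n)
          = (measure M U)\<^sup>2 / 4 * phi (vec 1 - vec (- 1) :: real ^ 'n) \<and>
        (0 < measure M U \<longrightarrow>
          (\<forall>c. (\<forall>(f :: real \<Rightarrow> real ^ 'n) lo hi. bounded_between U M f lo hi \<longrightarrow>
                  jensen_gap U M f \<le> c * (measure M U)\<^sup>2 * phi (hi - lo))
               \<longrightarrow> 1 / 4 \<le> c)))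
     \<and>
     (U \<noteq> {} \<and> Inf U < Sup U \<longrightarrow>
        finite_measure_on U (lebesgue_on U) \<and> equal_halves U (lebesgue_on U) \<and>
        0 < measure (lebesgue_on U) U)"
proof (intro conjI allI impI; (elim conjE)?)
  \<comment> \<open>This goal is treated separately because its hypothesis on \<open>c\<close> is
    quantified in the object logic, whereas \<open>sharp_constant\<close> takes it as a
    rule.\<close>
  fix M and c :: real
  assume "finite_measure_on U M" "equal_halves U M" "0 < measure M U"
    and "\<forall>(f :: real \<Rightarrow> real ^ 'n) lo hi. bounded_between U M f lo hi \<longrightarrow>
      jensen_gap U M f \<le> c * (measure M U)\<^sup>2 * phi (hi - lo)"
  then show "1 / 4 \<le> c"
    by (intro sharp_constant[where 'n = 'n]) blast+
qed (assumption | rule jensen_gap_le bounded_between_sgn_step jensen_gap_sgn_step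
    lebesgue_on_equal_halves assms)+

end
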